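(* If a hypergraph $\mathcal H=(V,\mathcal E)$ has the Helly property, then its edge intersection hypergraph $EI(\mathcal H)$ also has the Helly property.
   Context: A hypergraph $\mathcal H=(V,\mathcal E)$ consists of a finite vertex set $V$ and a set $\mathcal E$ of subsets of $V$ (hyperedges), without multiple hyperedges or loops. It has the Helly property if for every $\mathcal E'\subseteq\mathcal E$ such that any two members of $\mathcal E'$ have nonempty intersection, $\bigcap_{e\in\mathcal E'}e\neq\emptyset$. The edge intersection hypergraph is $EI(\mathcal H)=(V,\mathcal E^{EI})$ with $\mathcal E^{EI}=\{e_1\cap e_2 \mid e_1,e_2\in\mathcal E,\ e_1\neq e_2,\ |e_1\cap e_2|\ge 2\}$. *)

theory Defs
  imports Main
begin

type_synonym 'a hypergraph = "'a set \<times> 'a set set"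

abbreviation verts :: "'a hypergraph \<Rightarrow> 'a set" where
  "verts H \<equiv> fst H"

abbreviation hyperedges :: "'a hypergraph \<Rightarrow> 'a set set" where
  "hyperedges H \<equiv> snd H"

text \<open>
  Multiple hyperedges are excluded because the hyperedges form a set. A loop is a hyperedge
  with exactly one vertex. The empty hyperedge is not excluded.
\<close>

definition hypergraph :: "'a hypergraph \<Rightarrow> bool" where
  "hypergraph H \<longleftrightarrow>
     finite (verts H) \<and> (\<forall>e \<in> hyperedges H. e \<subseteq> verts H \<and> card e \<noteq> 1)"

text \<open>
  The two members need not be distinct; this matters only for the subfamily that consists of
  the empty hyperedge alone, which is thereby not required to have a common vertex.
  The empty subfamily imposes no condition either, since \<open>\<Inter>{} = UNIV\<close>.
\<close>

definition helly :: "'a hypergraph \<Rightarrow> bool" where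
  "helly H \<longleftrightarrow>
     (\<forall>E' \<subseteq> hyperedges H. (\<forall>e \<in> E'. \<forall>f \<in> E'. e \<inter> f \<noteq> {}) \<longrightarrow> \<Inter>E' \<noteq> {})"

definition EI :: "'a hypergraph \<Rightarrow> 'a hypergraph" where
  "EI H =
     (verts H,
      {e1 \<inter> e2 | e1 e2.
         e1 \<in> hyperedges H \<and> e2 \<in> hyperedges H \<and> e1 \<noteq> e2 \<and> card (e1 \<inter> e2) \<ge> 2})"

lemma hypergraph_EI: "hypergraph H \<Longrightarrow> hypergraph (EI H)"
  unfolding hypergraph_def EI_def by fastforce

end

theory Submission imports Defs begin

text \<open>
  Replace a pairwise intersecting family of intersections by the family of all hyperedges of the
  original hypergraph that contain one of its members. The new family is still pairwise
  intersecting, and it contains both constituents of each intersection, so a common vertex of it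
  is a common vertex of the given family.
\<close>

theorem theorem3:
  fixes H :: "'a hypergraph"
  assumes "hypergraph H" and "helly H"
  shows "helly (EI H)"
  unfolding helly_def
proof (intro allI impI)
  fix E'
  assume sub: "E' \<subseteq> hyperedges (EI H)"
    and meet: "\<forall>e\<in>E'. \<forall>f\<in>E'. e \<inter> f \<noteq> {}"
  \<comment> \<open>Taking every hyperedge above some member avoids choosing, for each member of
    \<open>E'\<close>, one of its possibly many representations as an intersection.\<close>
  define F where "F = {e \<in> hyperedges H. \<exists>a\<in>E'. a \<subseteq> e}"
  \<comment> \<open>If \<open>e\<close> contains \<open>a\<close> and \<open>f\<close> contains
    \<open>b\<close>, with \<open>a\<close> and \<open>b\<close> in \<open>E'\<close>, then
    \<open>e \<inter> f\<close> contains the nonempty set \<open>a \<inter> b\<close>.\<close>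
  have "\<forall>e\<in>F. \<forall>f\<in>F. e \<inter> f \<noteq> {}"
    using meet unfolding F_def by blast
  moreover have "F \<subseteq> hyperedges H"
    unfolding F_def by blast
  ultimately have "\<Inter>F \<noteq> {}"
    using \<open>helly H\<close> unfolding helly_def by blast
  moreover have "\<Inter>F \<subseteq> \<Inter>E'"
  proof (rule Inter_greatest)
    fix a
    assume "a \<in> E'"
    with sub have "a \<in> hyperedges (EI H)"
      by (rule subsetD)
    then obtain e1 e2 where "a = e1 \<inter> e2" "e1 \<in> hyperedges H" "e2 \<in> hyperedges H"
      unfolding EI_def by auto
    \<comment> \<open>Both constituents contain \<open>a\<close>, so \<open>a\<close> itself is the
      witness required by \<open>F\<close>.\<close>
    with \<open>a \<in> E'\<close> have "e1 \<in> F" "e2 \<in> F"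
      unfolding F_def by blast+
    with \<open>a = e1 \<inter> e2\<close> show "\<Inter>F \<subseteq> a"
      by blast
  qed
  ultimately show "\<Inter>E' \<noteq> {}"
    by blast
qed

end
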